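(* Let $t$ be a positive integer and, for every positive integer $r$, let $c_r:=\frac83(r+1)^2 2^{4r}$. Let $M$ be a $0,1$-matrix with $s$ rows and at least $2^{4c_{2t+2}}\cdot s$ distinct columns. Then $M$ has a $(2t+2)$-mixed minor.
   Context: A row (resp. column) division of a matrix is a partition of its rows (resp. columns) into intervals of consecutive rows (resp. columns). A $k$-division is a pair of a row division and a column division, each with exactly $k$ parts; its cells are the submatrices indexed by a row part and a column part. A matrix is mixed if it has at least two distinct rows and at least two distinct columns. A $k$-mixed minor of $M$ is a $k$-division of $M$ in which every cell is mixed. *)

theory Defs
  imports
    Complex_Main
    "HOL-Library.Disjoint_Sets"
    "Jordan_Normal_Form.DL_Submatrix"
begin

text \<open>A division of \<open>n\<close> consecutively indexed lines. Parts are automatically nonempty, since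
  \<open>partition_on\<close> excludes the empty set.\<close>

definition interval_division :: "nat \<Rightarrow> nat set set \<Rightarrow> bool" where
  "interval_division n P \<longleftrightarrow> partition_on {..<n} P \<and> (\<forall>I\<in>P. \<exists>a b. I = {a..<b})"

definition k_division :: "nat \<Rightarrow> 'a mat \<Rightarrow> nat set set \<Rightarrow> nat set set \<Rightarrow> bool" where
  "k_division k M R C \<longleftrightarrow>
     interval_division (dim_row M) R \<and> card R = k \<and>
     interval_division (dim_col M) C \<and> card C = k"

definition mixed :: "'a mat \<Rightarrow> bool" where
  "mixed A \<longleftrightarrow> card (set (rows A)) \<ge> 2 \<and> card (set (cols A)) \<ge> 2"

definition mixed_minor :: "nat \<Rightarrow> 'a mat \<Rightarrow> nat set set \<Rightarrow> nat set set \<Rightarrow> bool" where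
  "mixed_minor k M R C \<longleftrightarrow>
     k_division k M R C \<and> (\<forall>I\<in>R. \<forall>J\<in>C. mixed (submatrix M I J))"

definition c :: "nat \<Rightarrow> real" where
  "c r = 8 / 3 * (real r + 1)\<^sup>2 * 2 ^ (4 * r)"

end

theory Submission
  imports Defs
begin

text \<open>Choose representatives of the distinct columns and cut them into \<open>s\<close> blocks of \<open>2 ^ (4 * L)\<close>
  columns, where \<open>L \<le> c (2 * t + 2)\<close>. Reading a block row by row, the number of column types can
  at most double at a row, and it does not grow from row \<open>i\<close> to row \<open>i + 1\<close> unless these two rows
  form a mixed matrix on the block: otherwise they are equal or both constant there. Hence every
  block has at least \<open>4 * L - 1\<close> mixed row pairs. Marking these in a 0-1 matrix with one column
  per block gives more than \<open>L * s\<close> ones, and a Marcus-Tardos type theorem with exponential constant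
  (after Fox, and Cibulka and Kyncl) yields a division of it with a one in every cell, which
  pulls back to a mixed minor.\<close>

section \<open>Grid minors of sets of points\<close>

text \<open>A division is encoded by monotone labellings of rows and columns, so that contracting rows or
  columns is composition. Labels beyond \<open>l\<close> and \<open>k\<close> are allowed; they can be merged into
  the last part.\<close>

definition grid_minor :: "nat \<Rightarrow> nat \<Rightarrow> (nat \<times> nat) set \<Rightarrow> bool" where
  "grid_minor l k A \<longleftrightarrow> (\<exists>\<rho> \<gamma> :: nat \<Rightarrow> nat. mono \<rho> \<and> mono \<gamma> \<and>
     (\<forall>i<l. \<forall>j<k. \<exists>x y. (x, y) \<in> A \<and> \<rho> x = i \<and> \<gamma> y = j))"

lemma grid_minor_mono:
  assumes "grid_minor l k A" "A \<subseteq> B"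
  shows "grid_minor l k B"
  using assms unfolding grid_minor_def by (meson subsetD)

lemma grid_minor_converse:
  assumes "grid_minor l k A"
  shows "grid_minor k l (A\<inverse>)"
  using assms unfolding grid_minor_def converse_iff by blast

lemma grid_minor_image:
  assumes "grid_minor l k (map_prod f g ` A)" "mono f" "mono g"
  shows "grid_minor l k A"
proof -
  obtain \<rho> \<gamma> :: "nat \<Rightarrow> nat" where m: "mono \<rho>" "mono \<gamma>"
    and hit: "\<forall>i<l. \<forall>j<k. \<exists>x y. (x, y) \<in> map_prod f g ` A \<and> \<rho> x = i \<and> \<gamma> y = j"
    using assms(1) unfolding grid_minor_def by blast
  have "mono (\<rho> \<circ> f)" "mono (\<gamma> \<circ> g)"
    using m assms(2,3) by (auto simp: mono_def)
  moreover have "\<forall>i<l. \<forall>j<k. \<exists>x y. (x, y) \<in> A \<and> (\<rho> \<circ> f) x = i \<and> (\<gamma> \<circ> g) y = j"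
  proof (intro allI impI)
    fix i j assume "i < l" "j < k"
    then obtain x y where "(x, y) \<in> map_prod f g ` A" "\<rho> x = i" "\<gamma> y = j"
      using hit by blast
    then show "\<exists>x y. (x, y) \<in> A \<and> (\<rho> \<circ> f) x = i \<and> (\<gamma> \<circ> g) y = j"
      by auto
  qed
  ultimately show ?thesis unfolding grid_minor_def by blast
qed

lemma mono_rank: "finite Y \<Longrightarrow> mono (\<lambda>x::nat. card {z\<in>Y. z < x})"
  by (auto simp: mono_def intro!: card_mono)

text \<open>Ranks increase strictly along \<open>Y\<close> and stay below \<open>card Y\<close>, so
  counting gives surjectivity. They number rows in \<open>grid_minor_one\<close> and later cut the
  chosen columns into equal blocks.\<close>

lemma bij_betw_rank:
  fixes Y :: "nat set"
  assumes "finite Y"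
  shows "bij_betw (\<lambda>x. card {z\<in>Y. z < x}) Y {..<card Y}"
proof -
  let ?r = "\<lambda>x. card {z\<in>Y. z < x}"
  have less: "?r x < ?r y" if "x \<in> Y" "x < y" for x y
    using that assms by (intro psubset_card_mono) auto
  have inj: "inj_on ?r Y"
    by (rule linorder_inj_onI) (use less in \<open>auto dest: less_imp_neq\<close>)
  then have "card (?r ` Y) = card Y" by (rule card_image)
  moreover have "?r ` Y \<subseteq> {..<card Y}"
    using assms by (auto intro!: psubset_card_mono)
  ultimately have "?r ` Y = {..<card Y}"
    by (intro card_subset_eq) auto
  with inj show ?thesis by (simp add: bij_betw_def)
qed

section \<open>Grid minors with one column part, and with one more\<close>

lemma grid_minor_one:
  assumes "finite R" "l \<le> card R" "\<And>x. x \<in> R \<Longrightarrow> S x \<noteq> {}"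
  shows "grid_minor l (Suc 0) (Sigma R S)"
  unfolding grid_minor_def
proof (rule exI[of _ "\<lambda>x. card {z\<in>R. z < x}"], rule exI[of _ "\<lambda>_. 0"],
    intro conjI allI impI)
  show "mono (\<lambda>x. card {z\<in>R. z < x})" using assms(1) by (rule mono_rank)
  show "mono (\<lambda>_::nat. 0::nat)" by (simp add: mono_def)
  fix i j assume "i < l" "j < Suc 0"
  then have "i \<in> (\<lambda>x. card {z\<in>R. z < x}) ` R"
    using bij_betw_imp_surj_on[OF bij_betw_rank[OF assms(1)]] assms(2) by auto
  then show "\<exists>x y. (x, y) \<in> Sigma R S \<and> card {z\<in>R. z < x} = i \<and> 0 = j"
    using assms(3) \<open>j < Suc 0\<close> by fastforce
qed

text \<open>The columns from \<open>p\<close> on become the new last part. Every row of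
  \<open>R\<close> reaches them, so a row found for any old cell also serves the new one;
  \<open>Suc k\<close> guarantees that an old cell exists.\<close>

lemma grid_minor_Suc_right:
  assumes "grid_minor l (Suc k) (Sigma R (\<lambda>x. S x \<inter> {..<p}))"
    and "\<And>x. x \<in> R \<Longrightarrow> \<exists>y\<in>S x. p \<le> y"
  shows "grid_minor l (Suc (Suc k)) (Sigma R S)"
proof -
  obtain \<rho> \<gamma> :: "nat \<Rightarrow> nat" where m: "mono \<rho>" "mono \<gamma>"
    and hit: "\<And>i j. i < l \<Longrightarrow> j < Suc k \<Longrightarrow>
      \<exists>x y. x \<in> R \<and> y \<in> S x \<and> y < p \<and> \<rho> x = i \<and> \<gamma> y = j"
    using assms(1) unfolding grid_minor_def by auto
  \<comment> \<open>Surplus labels below \<open>p\<close> are capped at \<open>k\<close>, so that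
    none exceeds the new label \<open>Suc k\<close>.\<close>
  define \<gamma>' where "\<gamma>' y = (if y < p then min k (\<gamma> y) else Suc k)" for y
  have "mono \<gamma>'"
    using m(2) unfolding \<gamma>'_def mono_def by (auto simp: min_def le_Suc_eq) (meson le_trans)
  moreover have "\<exists>x y. (x, y) \<in> Sigma R S \<and> \<rho> x = i \<and> \<gamma>' y = j"
    if ij: "i < l" "j < Suc (Suc k)" for i j
  proof (cases "j = Suc k")
    case True
    obtain x where "x \<in> R" "\<rho> x = i" using hit[OF ij(1), of 0] by auto
    moreover obtain y where "y \<in> S x" "p \<le> y" using assms(2)[OF \<open>x \<in> R\<close>] by blast
    ultimately show ?thesis using True by (intro exI[of _ x] exI[of _ y]) (auto simp: \<gamma>'_def)
  next
    case False
    then obtain x y where "x \<in> R" "y \<in> S x" "y < p" "\<rho> x = i" "\<gamma> y = j"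
      using hit[OF ij(1), of j] ij(2) by auto
    then show ?thesis using False ij(2) by (intro exI[of _ x] exI[of _ y]) (auto simp: \<gamma>'_def)
  qed
  ultimately show ?thesis using m(1) unfolding grid_minor_def by blast
qed

lemma grid_minor_Suc_left:
  assumes "grid_minor l (Suc k) (Sigma R (\<lambda>x. S x \<inter> {p..}))"
    and "\<And>x. x \<in> R \<Longrightarrow> \<exists>y\<in>S x. y < p"
  shows "grid_minor l (Suc (Suc k)) (Sigma R S)"
proof -
  obtain \<rho> \<gamma> :: "nat \<Rightarrow> nat" where m: "mono \<rho>" "mono \<gamma>"
    and hit: "\<And>i j. i < l \<Longrightarrow> j < Suc k \<Longrightarrow>
      \<exists>x y. x \<in> R \<and> y \<in> S x \<and> p \<le> y \<and> \<rho> x = i \<and> \<gamma> y = j"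
    using assms(1) unfolding grid_minor_def by auto
  define \<gamma>' where "\<gamma>' y = (if y < p then 0 else Suc (\<gamma> y))" for y
  have "mono \<gamma>'"
    using m(2) unfolding \<gamma>'_def mono_def by auto
  moreover have "\<exists>x y. (x, y) \<in> Sigma R S \<and> \<rho> x = i \<and> \<gamma>' y = j"
    if ij: "i < l" "j < Suc (Suc k)" for i j
  proof (cases j)
    case 0
    obtain x where "x \<in> R" "\<rho> x = i" using hit[OF ij(1), of 0] by auto
    moreover obtain y where "y \<in> S x" "y < p" using assms(2)[OF \<open>x \<in> R\<close>] by blast
    ultimately show ?thesis using 0 by (intro exI[of _ x] exI[of _ y]) (auto simp: \<gamma>'_def)
  next
    case (Suc j')
    then obtain x y where "x \<in> R" "y \<in> S x" "p \<le> y" "\<rho> x = i" "\<gamma> y = j'"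
      using hit[OF ij(1), of j'] ij(2) by auto
    then show ?thesis using Suc by (intro exI[of _ x] exI[of _ y]) (auto simp: \<gamma>'_def)
  qed
  ultimately show ?thesis using m(1) unfolding grid_minor_def by blast
qed

section \<open>Counting points without grid minors\<close>

text \<open>Fox's argument: rows living in one half of the strip are handled by induction on \<open>a\<close>;
  a row meeting both halves has half of its points in one of them, and the other half of the strip
  serves as an extra column part.\<close>

lemma heavy_rows_bound:
  fixes S :: "nat \<Rightarrow> nat set" and w :: real
  assumes "finite R" "\<And>x. x \<in> R \<Longrightarrow> S x \<subseteq> {p..<p + 2 ^ a}"
    and "\<And>x. x \<in> R \<Longrightarrow> w \<le> card (S x)" "2 ^ k \<le> w"
    and "\<not> grid_minor l (Suc k) (Sigma R S)"
  shows "real (card R) * w \<le> real l * 2 ^ k * 4 ^ a"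
  using assms
proof (induction a arbitrary: p k R S w)
  case 0
  show ?case
  proof (cases "R = {}")
    case False
    then obtain x where x: "x \<in> R" by blast
    have "card (S x) \<le> 1" using card_mono[OF _ "0.prems"(2)[OF x]] by simp
    then have w: "w \<le> 1" using "0.prems"(3)[OF x] by linarith
    have k: "k = 0"
    proof (rule ccontr)
      assume "k \<noteq> 0"
      then have "(2::real) ^ 1 \<le> 2 ^ k" by (intro power_increasing) auto
      then show False using w "0.prems"(4) by simp
    qed
    have "S x \<noteq> {}" if "x \<in> R" for x
      using "0.prems"(3)[OF that] "0.prems"(4) k by auto
    then have "card R < l"
      using grid_minor_one[of R l S] "0.prems"(1,5) k by force
    then have "real (card R) * w \<le> real l * 1"
      using w "0.prems"(4) k by (intro mult_mono) auto
    then show ?thesis using k by simp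
  qed simp
next
  case (Suc a)
  have wpos: "0 < w" using less_le_trans[OF _ Suc.prems(4)] by simp
  have ne: "S x \<noteq> {}" if "x \<in> R" for x
    using Suc.prems(3)[OF that] wpos by auto
  have fin: "finite (S x)" if "x \<in> R" for x
    using Suc.prems(2)[OF that] finite_subset by blast
  define m where "m = p + 2 ^ a"
  define R1 where "R1 = {x\<in>R. S x \<subseteq> {..<m}}"
  define R2 where "R2 = {x\<in>R. S x \<subseteq> {m..}}"
  define Q where "Q = R - R1 - R2"
  define R3 where "R3 = {x\<in>Q. w / 2 \<le> card (S x \<inter> {..<m})}"
  define R4 where "R4 = {x\<in>Q. w / 2 \<le> card (S x \<inter> {m..})}"
  have sub: "R1 \<subseteq> R" "R2 \<subseteq> R" "R3 \<subseteq> R" "R4 \<subseteq> R"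
    by (auto simp: R1_def R2_def R3_def R4_def Q_def)
  have fins: "finite R1" "finite R2" "finite R3" "finite R4"
    using sub Suc.prems(1) finite_subset by blast+
  have S: "S x \<subseteq> {p..<p + 2 * 2 ^ a}" if "x \<in> R" for x
    using Suc.prems(2)[OF that] by simp
  have "R \<subseteq> R1 \<union> R2 \<union> R3 \<union> R4"
  proof
    fix x assume x: "x \<in> R"
    have "card (S x) = card ((S x \<inter> {..<m}) \<union> (S x \<inter> {m..}))"
      by (rule arg_cong[where f = card]) auto
    also have "\<dots> \<le> card (S x \<inter> {..<m}) + card (S x \<inter> {m..})"
      by (rule card_Un_le)
    finally show "x \<in> R1 \<union> R2 \<union> R3 \<union> R4"
      using Suc.prems(3)[OF x] x unfolding R3_def R4_def Q_def by force
  qed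
  then have "card R \<le> card (R1 \<union> R2 \<union> R3 \<union> R4)"
    using fins by (intro card_mono) auto
  also have "\<dots> \<le> card R1 + card R2 + card R3 + card R4"
    by (meson add_mono card_Un_le le_refl order_trans)
  finally have cardR: "real (card R) \<le> real (card R1) + card R2 + card R3 + card R4"
    by linarith
  have 1: "real (card R1) * w \<le> real l * 2 ^ k * 4 ^ a"
  proof (rule Suc.IH[of R1 S p w k])
    show "S x \<subseteq> {p..<p + 2 ^ a}" if "x \<in> R1" for x
      using S[of x] that unfolding R1_def m_def by fastforce
    show "\<not> grid_minor l (Suc k) (Sigma R1 S)"
      using Suc.prems(5) sub(1) grid_minor_mono[of _ _ "Sigma R1 S" "Sigma R S"] by blast
  qed (use fins Suc.prems sub in auto)
  have 2: "real (card R2) * w \<le> real l * 2 ^ k * 4 ^ a"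
  proof (rule Suc.IH[of R2 S m w k])
    show "S x \<subseteq> {m..<m + 2 ^ a}" if "x \<in> R2" for x
      using S[of x] that unfolding R2_def m_def by fastforce
    show "\<not> grid_minor l (Suc k) (Sigma R2 S)"
      using Suc.prems(5) sub(2) grid_minor_mono[of _ _ "Sigma R2 S" "Sigma R S"] by blast
  qed (use fins Suc.prems sub in auto)
  show ?case
  proof (cases k)
    \<comment> \<open>No column part is left to give up, so rows are counted directly: fewer than
      \<open>l\<close> of them, each forcing \<open>w \<le> 2 ^ Suc a\<close>.\<close>
    case 0
    then have "card R < l"
      using grid_minor_one[of R l S] Suc.prems(1,5) ne by force
    moreover have "w \<le> 4 ^ Suc a" if "x \<in> R" for x
    proof -
      have "card (S x) \<le> 2 ^ Suc a"
        using card_mono[OF _ Suc.prems(2)[OF that]] by simp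
      also have "\<dots> \<le> (4::nat) ^ Suc a" by (rule power_mono) auto
      finally have "real (card (S x)) \<le> 4 ^ Suc a"
        by (metis of_nat_le_iff of_nat_numeral of_nat_power)
      then show ?thesis using Suc.prems(3)[OF that] by simp
    qed
    ultimately have "real (card R) * w \<le> real l * 4 ^ Suc a"
      using wpos by (cases "R = {}") (auto intro!: mult_mono)
    then show ?thesis using 0 by simp
  next
    case (Suc k')
    \<comment> \<open>Halving \<open>w\<close> goes together with giving up one column part, so the
      hypothesis \<open>2 ^ k \<le> w\<close> is inherited.\<close>
    have w2: "2 ^ k' \<le> w / 2" using Suc.prems(4) Suc by simp
    have nosub: "\<not> grid_minor l (Suc (Suc k')) (Sigma R' S)" if "R' \<subseteq> R" for R'
      using Suc.prems(5) that grid_minor_mono[of _ _ "Sigma R' S" "Sigma R S"] Suc by blast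
    have 3: "real (card R3) * (w / 2) \<le> real l * 2 ^ k' * 4 ^ a"
    proof (rule Suc.IH[of R3 "\<lambda>x. S x \<inter> {..<m}" p "w / 2" k'])
      show "S x \<inter> {..<m} \<subseteq> {p..<p + 2 ^ a}" if "x \<in> R3" for x
        using S[of x] that sub unfolding m_def by fastforce
      have "\<exists>y\<in>S x. m \<le> y" if "x \<in> R3" for x
        using that unfolding R3_def Q_def R1_def by force
      then show "\<not> grid_minor l (Suc k') (SIGMA x:R3. S x \<inter> {..<m})"
        using grid_minor_Suc_right[of l k' R3 S m] nosub[OF sub(3)] by blast
    qed (use fins w2 in \<open>auto simp: R3_def\<close>)
    have 4: "real (card R4) * (w / 2) \<le> real l * 2 ^ k' * 4 ^ a"
    proof (rule Suc.IH[of R4 "\<lambda>x. S x \<inter> {m..}" m "w / 2" k'])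
      show "S x \<inter> {m..} \<subseteq> {m..<m + 2 ^ a}" if "x \<in> R4" for x
        using S[of x] that sub unfolding m_def by fastforce
      have "\<exists>y\<in>S x. y < m" if "x \<in> R4" for x
        using that unfolding R4_def Q_def R2_def by force
      then show "\<not> grid_minor l (Suc k') (SIGMA x:R4. S x \<inter> {m..})"
        using grid_minor_Suc_left[of l k' R4 S m] nosub[OF sub(4)] by blast
    qed (use fins w2 in \<open>auto simp: R4_def\<close>)
    have "real (card R) * w \<le> (real (card R1) + card R2 + card R3 + card R4) * w"
      using cardR wpos by (intro mult_right_mono) auto
    \<comment> \<open>All four classes contribute the same amount: for crossing rows the halved
      \<open>w\<close> is offset by \<open>2 ^ k'\<close> being half of \<open>2 ^ k\<close>. Hence
      the base 4.\<close>
    also have "\<dots> \<le> real l * 2 ^ k * 4 ^ Suc a"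
      using 1 2 3 4 Suc by (simp add: algebra_simps)
    finally show ?thesis .
  qed
qed

section \<open>Splitting row weights along powers of two\<close>

lemma sum_powers_of_two: "k \<le> n \<Longrightarrow> 2 ^ k + (\<Sum>b=k..<n. 2 ^ b) = (2::nat) ^ n"
  by (induction n rule: dec_induct) auto

text \<open>If \<open>m\<close> is at least \<open>2 ^ k\<close>, the geometric series up to the
  largest power below or equal to \<open>m\<close>, together with \<open>2 ^ k\<close>, exceeds
  \<open>m\<close>; otherwise \<open>2 ^ k\<close> alone suffices. A row's weight is thus charged to
  the thresholds it passes.\<close>

lemma le_sum_powers_below:
  fixes m :: nat
  assumes "m < 2 ^ n"
  shows "m \<le> 2 ^ k + (\<Sum>b=k..<n. if 2 ^ b \<le> m then 2 ^ b else 0)"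
  using assms
proof (induction n)
  case (Suc n)
  consider "m < 2 ^ n" | "2 ^ n \<le> m" "k \<le> n" | "n < k" by linarith
  then show ?case
  proof cases
    case 1
    then show ?thesis using Suc.IH by (cases "k \<le> n") auto
  next
    case 2
    have "(\<Sum>b=k..<Suc n. if 2 ^ b \<le> m then 2 ^ b else 0) = (\<Sum>b=k..<Suc n. (2::nat) ^ b)"
    proof (rule sum.cong[OF refl])
      fix b assume "b \<in> {k..<Suc n}"
      then have "(2::nat) ^ b \<le> 2 ^ n" by (intro power_increasing) auto
      then show "(if 2 ^ b \<le> m then 2 ^ b else 0) = (2::nat) ^ b" using le_trans[OF _ 2(1)] by simp
    qed
    then show ?thesis using sum_powers_of_two[of k "Suc n"] 2 Suc.prems by simp
  next
    case 3
    then have "(2::nat) ^ Suc n \<le> 2 ^ k" by (intro power_increasing) auto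
    then show ?thesis using Suc.prems by linarith
  qed
qed simp

text \<open>Summing over the dyadic weight classes, rather than charging every heavy row the full width
  \<open>2 ^ a\<close>, is what brings the final constant down to order \<open>2 ^ (4 * k)\<close>.\<close>

lemma strip_bound:
  fixes S :: "nat \<Rightarrow> nat set"
  assumes "finite R" "\<And>x. x \<in> R \<Longrightarrow> S x \<subseteq> {p..<p + 2 ^ a}"
    and "\<not> grid_minor l (Suc k) (Sigma R S)"
  shows "card (Sigma R S) \<le> 2 ^ k * card R + (Suc a - k) * (l * 2 ^ k * 4 ^ a)"
proof -
  define H where "H b = {x\<in>R. 2 ^ b \<le> card (S x)}" for b
  have fin: "finite (S x)" if "x \<in> R" for x
    using assms(2)[OF that] finite_subset by blast
  \<comment> \<open>Thresholds beyond \<open>a\<close> are never met, which leaves the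
    \<open>Suc a - k\<close> exponents from \<open>k\<close> to \<open>a\<close>.\<close>
  have lt: "card (S x) < 2 ^ Suc a" if "x \<in> R" for x
    using card_mono[OF _ assms(2)[OF that]] by (auto intro: le_less_trans)
  have H: "2 ^ b * card (H b) \<le> l * 2 ^ k * 4 ^ a" if "k \<le> b" for b
  proof -
    have "real (card (H b)) * 2 ^ b \<le> real l * 2 ^ k * 4 ^ a"
    proof (rule heavy_rows_bound)
      show "(2::real) ^ b \<le> real (card (S x))" if "x \<in> H b" for x
        using that unfolding H_def by simp
      show "\<not> grid_minor l (Suc k) (Sigma (H b) S)"
        using assms(3) grid_minor_mono[of l "Suc k" "Sigma (H b) S" "Sigma R S"]
        unfolding H_def by blast
    qed (use assms that in \<open>auto simp: H_def intro!: power_increasing\<close>)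
    then have "real (2 ^ b * card (H b)) \<le> real (l * 2 ^ k * 4 ^ a)"
      by (simp add: mult.commute)
    then show ?thesis by (simp only: of_nat_le_iff)
  qed
  have "card (Sigma R S) = (\<Sum>x\<in>R. card (S x))"
    using assms(1) fin by (intro card_SigmaI) auto
  also have "\<dots> \<le> (\<Sum>x\<in>R. 2 ^ k + (\<Sum>b=k..<Suc a. if 2 ^ b \<le> card (S x) then 2 ^ b else 0))"
    using lt by (intro sum_mono le_sum_powers_below)
  also have "\<dots> = 2 ^ k * card R + (\<Sum>b=k..<Suc a. \<Sum>x\<in>R. if 2 ^ b \<le> card (S x) then 2 ^ b else 0)"
    unfolding sum.distrib by (subst (2) sum.swap) simp
  also have "(\<Sum>b=k..<Suc a. \<Sum>x\<in>R. if 2 ^ b \<le> card (S x) then 2 ^ b else 0)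
      = (\<Sum>b=k..<Suc a. 2 ^ b * card (H b))"
    using assms(1) by (simp add: sum.If_cases H_def Int_def mult.commute del: sum.op_ivl_Suc)
  also have "\<dots> \<le> (\<Sum>b=k..<Suc a. l * 2 ^ k * 4 ^ a)"
    using H by (intro sum_mono) auto
  finally show ?thesis by simp
qed

text \<open>\<open>strip_bound\<close> is summed over strips of \<open>2 ^ a\<close> columns. Pairs
  of a strip and a row meeting it are exactly the contracted points, so the terms
  \<open>2 ^ k * card (R q)\<close> add up to the first summand.\<close>

lemma contract_columns_bound:
  assumes "finite A" "\<And>x y. (x, y) \<in> A \<Longrightarrow> y div 2 ^ a < n"
    and "\<not> grid_minor l (Suc k) A"
  shows "card A \<le> 2 ^ k * card (map_prod id (\<lambda>y. y div 2 ^ a) ` A)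
      + n * ((Suc a - k) * (l * 2 ^ k * 4 ^ a))"
proof -
  define S where "S q x = {y. (x, y) \<in> A \<and> y div 2 ^ a = q}" for q x
  define R where "R q = {x. S q x \<noteq> {}}" for q
  let ?Y = "(Suc a - k) * (l * 2 ^ k * 4 ^ a)"
  have finR: "finite (R q)" for q
    by (rule finite_subset[OF _ finite_imageI[OF assms(1), of fst]])
      (force simp: R_def S_def image_iff)
  have Aeq: "A = (\<Union>q<n. Sigma (R q) (S q))"
    using assms(2) by (auto simp: R_def S_def)
  have sub: "Sigma (R q) (S q) \<subseteq> A" for q by (auto simp: S_def)
  have "card A \<le> (\<Sum>q<n. card (Sigma (R q) (S q)))"
    by (subst Aeq) (rule card_UN_le, simp)
  also have "\<dots> \<le> (\<Sum>q<n. 2 ^ k * card (R q) + ?Y)"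
  proof (rule sum_mono, rule strip_bound)
    fix q
    show "S q x \<subseteq> {q * 2 ^ a..<q * 2 ^ a + 2 ^ a}" for x
      by (auto simp: S_def) (metis dividend_less_div_times mult.commute add.commute zero_less_numeral zero_less_power)
    show "\<not> grid_minor l (Suc k) (Sigma (R q) (S q))"
      using assms(3) grid_minor_mono[OF _ sub] by blast
  qed (rule finR)
  also have "\<dots> = 2 ^ k * (\<Sum>q<n. card (R q)) + n * ?Y"
    by (simp add: sum.distrib sum_distrib_left)
  also have "(\<Sum>q<n. card (R q)) = card (\<Union>q<n. R q \<times> {q})"
    using finR by (subst card_UN_disjoint) (auto simp: card_cartesian_product)
  also have "(\<Union>q<n. R q \<times> {q}) = map_prod id (\<lambda>y. y div 2 ^ a) ` A"
    using assms(2) by (force simp: R_def S_def)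
  finally show ?thesis .
qed

text \<open>Contracting groups of \<open>t = 4 ^ Suc k\<close> columns, and then of \<open>t\<close> rows, loses a factor
  \<open>(2 ^ k)\<^sup>2 = t / 4\<close> each time \<open>n\<close> shrinks by a factor \<open>t\<close>. Rounding up \<open>n / t\<close> costs at most a
  factor 2, so the recursion still contracts by 1/2.\<close>

lemma grid_minor_free_card_le:
  assumes "A \<subseteq> {..<n} \<times> {..<n}" "\<not> grid_minor (Suc k) (Suc k) A"
  shows "card A \<le> 2 * (k + 2)\<^sup>2 * 16 ^ Suc k * n"
  using assms
proof (induction n arbitrary: A rule: less_induct)
  case (less n)
  define s :: nat where "s = 2 ^ k"
  define t :: nat where "t = 2 ^ (2 * k + 2)"
  define C :: nat where "C = 2 * (k + 2)\<^sup>2 * 16 ^ Suc k"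
  have t: "t = 4 * s * s"
    by (simp add: t_def s_def power_add power_mult power2_eq_square flip: power_mult_distrib)
  have s: "1 \<le> s" by (simp add: s_def)
  have tt: "t * t = 16 ^ Suc k"
    by (simp add: t_def flip: power_add) (simp add: power_add power_mult)
  have C: "C = 2 * (k + 2)\<^sup>2 * (t * t)" by (simp add: C_def tt)
  have finA: "finite A" using less.prems(1) finite_subset by blast
  show ?case
  proof (cases "n \<le> C")
    \<comment> \<open>For small \<open>n\<close> the full square is already within the bound; the
      other case then has \<open>t < n\<close>.\<close>
    case True
    have "card A \<le> card ({..<n} \<times> {..<n})"
      using less.prems(1) by (intro card_mono) auto
    also have "\<dots> = n * n" by simp
    also have "\<dots> \<le> C * n" using True by simp
    finally show ?thesis by (simp add: C_def)
  next
    case False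
    have t4: "4 \<le> t" using s by (simp add: t)
    have "t \<le> t * t" by simp
    also have "\<dots> \<le> C" unfolding C by simp
    finally have tn: "t < n" using False by simp
    \<comment> \<open>This is \<open>n / t\<close> rounded up.\<close>
    define n' where "n' = Suc ((n - 1) div t)"
    have div: "y div t < n'" if "y < n" for y
      unfolding n'_def using that by (simp add: div_le_mono less_Suc_eq_le)
    have "t * ((n - 1) div t) \<le> n - 1" by simp
    then have tn': "t * n' \<le> 2 * n" using tn unfolding n'_def mult_Suc_right by linarith
    have "4 * n' \<le> t * n'" using t4 by simp
    then have n': "n' < n" using tn' tn t4 by linarith
    \<comment> \<open>The error per strip in \<open>contract_columns_bound\<close> for
      \<open>a = 2 * k + 2\<close> and \<open>l = Suc k\<close>.\<close>
    define Y where "Y = (k + 3) * (Suc k * s * (t * t))"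
    have Y: "(Suc (2 * k + 2) - k) * (Suc k * 2 ^ k * 4 ^ (2 * k + 2)) = Y"
      unfolding Y_def s_def t_def by (simp flip: power_mult_distrib)
    let ?d = "\<lambda>y. y div t"
    have mono_d: "mono ?d" by (simp add: mono_def div_le_mono)
    define A1 where "A1 = map_prod id ?d ` A"
    \<comment> \<open>Transposing lets the column contraction act on the original rows.\<close>
    define A2 where "A2 = map_prod id ?d ` (A1\<inverse>)"
    have nA1: "\<not> grid_minor (Suc k) (Suc k) (A1\<inverse>)"
      using less.prems(2) grid_minor_image[of _ _ id ?d A] grid_minor_converse[of _ _ "A1\<inverse>"]
        mono_d by (auto simp: A1_def mono_def)
    have nA2: "\<not> grid_minor (Suc k) (Suc k) A2"
      using nA1 grid_minor_image[of _ _ id ?d "A1\<inverse>"] mono_d by (auto simp: A2_def mono_def)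
    have fin1: "finite (A1\<inverse>)" using finA by (simp add: A1_def)
    have "card A \<le> s * card A1 + n' * Y"
      using contract_columns_bound[of A "2 * k + 2" n' "Suc k" k] finA less.prems div
      unfolding Y A1_def s_def t_def[symmetric] by auto
    moreover have "card A1 \<le> s * card A2 + n' * Y"
    proof -
      have "y div t < n'" if "(x, y) \<in> A1\<inverse>" for x y
        using that div less.prems(1) by (auto simp: A1_def)
      then show ?thesis
        using contract_columns_bound[of "A1\<inverse>" "2 * k + 2" n' "Suc k" k] fin1 nA1
        unfolding Y A2_def s_def t_def[symmetric] by simp
    qed
    moreover have "card A2 \<le> C * n'"
    proof -
      have "A2 \<subseteq> {..<n'} \<times> {..<n'}"
        using less.prems(1) div by (auto simp: A2_def A1_def)
      then show ?thesis using less.IH[OF n' _ nA2] unfolding C_def by blast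
    qed
    ultimately have "card A \<le> s * (s * (C * n') + n' * Y) + n' * Y"
      by (meson add_mono le_refl mult_le_mono2 order_trans)
    \<comment> \<open>The factor 4 turns \<open>s * s\<close> into \<open>t\<close>. The recursive
      term and the error term then each take \<open>2 * C * n\<close>, which is what fixes
      \<open>C\<close>.\<close>
    then have "4 * card A \<le> 4 * (s * (s * (C * n') + n' * Y) + n' * Y)" by simp
    also have "\<dots> = C * (t * n') + (4 * s * s + 4 * s) * ((k + 3) * Suc k) * t * (t * n')"
      unfolding Y_def t by (simp add: algebra_simps)
    also have "\<dots> \<le> C * (2 * n) + (2 * t) * (k + 2)\<^sup>2 * t * (2 * n)"
    proof (rule add_mono[OF mult_le_mono2[OF tn']
          mult_le_mono[OF mult_le_mono[OF mult_le_mono[OF _ _] order_refl] tn']])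
      have "4 * s * 1 \<le> 4 * s * s" using s by (intro mult_le_mono2)
      then show "4 * s * s + 4 * s \<le> 2 * t" by (simp add: t)
      show "(k + 3) * Suc k \<le> (k + 2)\<^sup>2" by (simp add: power2_eq_square algebra_simps)
    qed
    also have "\<dots> = 4 * (C * n)" unfolding C by (simp add: algebra_simps)
    finally have "card A \<le> C * n" by simp
    then show ?thesis unfolding C_def .
  qed
qed

section \<open>Mixed pairs of consecutive rows\<close>

text \<open>An entrywise form of mixedness for two consecutive rows. \<open>Y\<close> is an
  arbitrary set because the representatives in a block need not be consecutive columns.\<close>

definition mixed_cut :: "(nat \<Rightarrow> nat \<Rightarrow> 'a) \<Rightarrow> nat set \<Rightarrow> nat \<Rightarrow> bool" where
  "mixed_cut a Y i \<longleftrightarrow> (\<exists>y\<in>Y. a i y \<noteq> a (Suc i) y) \<and>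
     (\<exists>r\<in>{i, Suc i}. \<exists>y\<in>Y. \<exists>y'\<in>Y. a r y \<noteq> a r y')"

lemma card_column_types_le:
  assumes "finite Y" "\<And>r y. r < n \<Longrightarrow> y \<in> Y \<Longrightarrow> a r y \<in> {u, v}"
  shows "card ((\<lambda>y. map (\<lambda>r. a r y) [0..<n]) ` Y)
    \<le> 2 ^ Suc (card {i. Suc i < n \<and> mixed_cut a Y i})"
  using assms(2)
proof (induction n)
  case 0
  have "(\<lambda>y. map (\<lambda>r. a r y) [0..<0]) ` Y \<subseteq> {[]}" by auto
  then have "card ((\<lambda>y. map (\<lambda>r. a r y) [0..<0]) ` Y) \<le> card {[] :: 'a list}"
    by (intro card_mono) auto
  then show ?case by simp
next
  case (Suc n)
  define P where "P m = (\<lambda>y. map (\<lambda>r. a r y) [0..<m]) ` Y" for m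
  define D where "D m = {i. Suc i < m \<and> mixed_cut a Y i}" for m
  have finP: "finite (P m)" for m using assms(1) by (simp add: P_def)
  have IH: "card (P n) \<le> 2 ^ Suc (card (D n))"
    using Suc unfolding P_def D_def by auto
  have finD: "finite (D m)" for m
    by (rule finite_subset[of _ "{..<m}"]) (auto simp: D_def)
  have "card (P (Suc n)) \<le> 2 ^ Suc (card (D (Suc n)))"
  proof (cases n)
    case 0
    \<comment> \<open>The first row has no predecessor; its two types account for the
      \<open>Suc\<close> in the exponent.\<close>
    have "P (Suc n) \<subseteq> {[u], [v]}" using Suc.prems 0 by (auto simp: P_def)
    then have "card (P (Suc n)) \<le> card {[u], [v]}" by (intro card_mono) auto
    also have "\<dots> \<le> 2" by (simp add: card_insert_if)
    finally show ?thesis using 0 by (simp add: D_def)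
  next
    case (Suc p)
    show ?thesis
    proof (cases "mixed_cut a Y p")
      case True
      have "P (Suc n) \<subseteq> (\<lambda>(z, b). z @ [b]) ` (P n \<times> {u, v})"
        using Suc.prems by (force simp: P_def)
      then have "card (P (Suc n)) \<le> card ((\<lambda>(z, b). z @ [b]) ` (P n \<times> {u, v}))"
        using finP by (intro card_mono) auto
      also have "\<dots> \<le> card (P n \<times> {u, v})" using finP by (intro card_image_le) auto
      also have "\<dots> \<le> card (P n) * 2"
        unfolding card_cartesian_product by (intro mult_le_mono2) (simp add: card_insert_if)
      finally have "card (P (Suc n)) \<le> 2 ^ Suc (Suc (card (D n)))" using IH by simp
      moreover have "D (Suc n) = insert p (D n)" "p \<notin> D n"
        using True Suc by (auto simp: D_def less_Suc_eq)
      ultimately show ?thesis using finD by simp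
    next
      case False
      \<comment> \<open>Without a mixed cut the new entry is a function of the earlier ones:
        constant if the two rows differ somewhere, and a copy of the last entry if they
        agree.\<close>
      have "\<exists>f. \<forall>y\<in>Y. a n y = f (map (\<lambda>r. a r y) [0..<n])"
      proof (cases "\<exists>y\<in>Y. a p y \<noteq> a n y")
        case True
        then have const: "a n y = a n y'" if "y \<in> Y" "y' \<in> Y" for y y'
          using False that Suc unfolding mixed_cut_def by blast
        obtain y' where "y' \<in> Y" using True by blast
        then show ?thesis using const by (intro exI[of _ "\<lambda>_. a n y'"]) blast
      next
        case False
        then show ?thesis using Suc by (intro exI[of _ last]) auto
      qed
      then obtain f where f: "\<And>y. y \<in> Y \<Longrightarrow> a n y = f (map (\<lambda>r. a r y) [0..<n])"
        by blast
      have "P (Suc n) \<subseteq> (\<lambda>z. z @ [f z]) ` P n"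
        using f by (auto simp: P_def)
      then have "card (P (Suc n)) \<le> card (P n)"
        using surj_card_le[OF finP] by blast
      moreover have "D (Suc n) = D n" using False Suc by (auto simp: D_def less_Suc_eq)
      ultimately show ?thesis using IH by simp
    qed
  qed
  then show ?case unfolding P_def D_def .
qed

section \<open>From grid minors to mixed minors\<close>

lemma nat_interval_eq:
  fixes I :: "nat set"
  assumes "finite I" "I \<noteq> {}" "\<And>x y z. x \<in> I \<Longrightarrow> z \<in> I \<Longrightarrow> x \<le> y \<Longrightarrow> y \<le> z \<Longrightarrow> y \<in> I"
  shows "I = {Min I..<Suc (Max I)}"
proof (intro equalityI subsetI)
  fix y assume "y \<in> {Min I..<Suc (Max I)}"
  then show "y \<in> I"
    using assms(3)[OF Min_in[OF assms(1,2)] Max_in[OF assms(1,2)]] by simp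
qed (use assms(1) in \<open>simp add: less_Suc_eq_le\<close>)

text \<open>Fibres of a monotone map are convex, hence intervals. Surjectivity makes them nonempty,
  and therefore distinct for distinct labels.\<close>

lemma interval_division_fibres:
  fixes f :: "nat \<Rightarrow> nat"
  assumes "mono f" "f ` {..<n} = {..<k}"
  defines "P \<equiv> (\<lambda>i. {r. r < n \<and> f r = i}) ` {..<k}"
  shows "interval_division n P" "card P = k"
proof -
  have ne: "\<exists>r<n. f r = i" if "i < k" for i
  proof -
    have "i \<in> f ` {..<n}" using assms(2) that by simp
    then show ?thesis by auto
  qed
  have lt: "f r < k" if "r < n" for r using assms(2) that by blast
  have "partition_on {..<n} P"
    by (rule partition_onI) (use ne lt in \<open>auto simp: P_def disjnt_def\<close>)
  moreover have "\<exists>a b. I = {a..<b}" if IP: "I \<in> P" for I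
  proof -
    obtain i where I: "I = {r. r < n \<and> f r = i}" "i < k" using IP unfolding P_def by blast
    have "I = {Min I..<Suc (Max I)}"
    proof (rule nat_interval_eq)
      show "I \<noteq> {}" "finite I" using ne[OF I(2)] I(1) by auto
      show "y \<in> I" if "x \<in> I" "z \<in> I" "x \<le> y" "y \<le> z" for x y z
      using that monoD[OF assms(1), of x y] monoD[OF assms(1), of y z] I(1) by auto
    qed
    then show ?thesis by blast
  qed
  ultimately show "interval_division n P" by (auto simp: interval_division_def)
  have "inj_on (\<lambda>i. {r. r < n \<and> f r = i}) {..<k}"
    by (rule inj_onI) (use ne in blast)
  then show "card P = k" by (simp add: P_def card_image)
qed

lemma card_ge_2I: "finite X \<Longrightarrow> x \<in> X \<Longrightarrow> y \<in> X \<Longrightarrow> x \<noteq> y \<Longrightarrow> 2 \<le> card X"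
  by (metis card_2_iff card_mono empty_subsetI insert_subset)

lemma mixed_submatrixI:
  assumes I: "I \<subseteq> {..<dim_row M}" and J: "J \<subseteq> {..<dim_col M}"
    and rows: "i \<in> I" "i' \<in> I" "j \<in> J" "M $$ (i, j) \<noteq> M $$ (i', j)"
    and cols: "r \<in> I" "q \<in> J" "q' \<in> J" "M $$ (r, q) \<noteq> M $$ (r, q')"
  shows "mixed (submatrix M I J)"
proof -
  let ?S = "submatrix M I J"
  \<comment> \<open>Ranks in \<open>I\<close> and \<open>J\<close> are the positions inside the
    submatrix.\<close>
  define x where "x i = card {a\<in>I. a < i}" for i
  define y where "y j = card {a\<in>J. a < j}" for j
  have x: "x i < dim_row ?S" if "i \<in> I" for i
    using that I finite_subset[OF I] unfolding x_def dim_submatrix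
    by (intro psubset_card_mono) (auto simp: subset_eq)
  have y: "y j < dim_col ?S" if "j \<in> J" for j
    using that J finite_subset[OF J] unfolding y_def dim_submatrix
    by (intro psubset_card_mono) (auto simp: subset_eq)
  have S: "?S $$ (x i, y j) = M $$ (i, j)" if "i \<in> I" "j \<in> J" for i j
    unfolding x_def y_def using that I J by (intro submatrix_index_card) auto
  have "row ?S (x i) \<noteq> row ?S (x i')"
  proof
    assume "row ?S (x i) = row ?S (x i')"
    then have "row ?S (x i) $ y j = row ?S (x i') $ y j" by simp
    then show False using rows S x y by simp
  qed
  moreover have "row ?S (x i) \<in> set (rows ?S)" if "i \<in> I" for i
    using x[OF that] by (auto simp: rows_def)
  ultimately have "2 \<le> card (set (rows ?S))"
    using rows(1,2) by (intro card_ge_2I) auto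
  moreover have "col ?S (y q) \<noteq> col ?S (y q')"
  proof
    assume "col ?S (y q) = col ?S (y q')"
    then have "col ?S (y q) $ x r = col ?S (y q') $ x r" by simp
    then show False using cols S x y by simp
  qed
  moreover have "col ?S (y j) \<in> set (cols ?S)" if "j \<in> J" for j
    using y[OF that] by (auto simp: cols_def)
  ultimately show ?thesis
    using card_ge_2I[OF _ _ _ \<open>col ?S (y q) \<noteq> col ?S (y q')\<close>] cols(2,3) unfolding mixed_def by simp
qed

text \<open>Each point of \<open>A\<close> records a mixed cut lying inside one fibre of
  \<open>f\<close> and one of \<open>g\<close>. Composing labels puts such a cut into every cell of
  the pulled-back division.\<close>

lemma mixed_minorI:
  assumes grid: "grid_minor (Suc k) (Suc k) A"
    and mono: "mono f" "mono g"
    and A: "\<And>j q. (j, q) \<in> A \<Longrightarrow> \<exists>i Y. mixed_cut (\<lambda>r y. M $$ (r, y)) Y i \<and> Suc i < dim_row M \<and>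
       f i = j \<and> f (Suc i) = j \<and> (\<forall>y\<in>Y. y < dim_col M \<and> g y = q)"
  shows "\<exists>R C. mixed_minor (Suc k) M R C"
proof -
  obtain \<rho> \<gamma> :: "nat \<Rightarrow> nat" where m: "mono \<rho>" "mono \<gamma>"
    and hit: "\<And>i j. i < Suc k \<Longrightarrow> j < Suc k \<Longrightarrow> \<exists>x y. (x, y) \<in> A \<and> \<rho> x = i \<and> \<gamma> y = j"
    using grid unfolding grid_minor_def by blast
  \<comment> \<open>Merging surplus labels into the last part leaves exactly \<open>Suc k\<close>
    parts.\<close>
  define F where "F r = min k (\<rho> (f r))" for r
  define G where "G y = min k (\<gamma> (g y))" for y
  have mono': "mono F" "mono G"
  proof -
    show "mono F" unfolding F_def
      by (intro monoI min.mono order_refl monoD[OF m(1)] monoD[OF mono(1)])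
    show "mono G" unfolding G_def
      by (intro monoI min.mono order_refl monoD[OF m(2)] monoD[OF mono(2)])
  qed
  have cell: "\<exists>i Y. mixed_cut (\<lambda>r y. M $$ (r, y)) Y i \<and> Suc i < dim_row M \<and>
      F i = i' \<and> F (Suc i) = i' \<and> (\<forall>y\<in>Y. y < dim_col M \<and> G y = j')"
    if "i' < Suc k" "j' < Suc k" for i' j'
  proof -
    obtain j q where jq: "(j, q) \<in> A" "\<rho> j = i'" "\<gamma> q = j'" using hit[OF \<open>i' < Suc k\<close> \<open>j' < Suc k\<close>] by blast
    obtain i Y where "mixed_cut (\<lambda>r y. M $$ (r, y)) Y i" "Suc i < dim_row M"
      "f i = j" "f (Suc i) = j" "\<forall>y\<in>Y. y < dim_col M \<and> g y = q"
      using A[OF jq(1)] by blast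
    then show ?thesis
      using that jq(2,3) by (intro exI[of _ i] exI[of _ Y]) (auto simp: F_def G_def)
  qed
  have surjF: "F ` {..<dim_row M} = {..<Suc k}"
  proof (intro equalityI subsetI)
    fix i' assume "i' \<in> {..<Suc k}"
    then obtain i where "Suc i < dim_row M" "F i = i'" using cell[of i' 0] by auto
    then show "i' \<in> F ` {..<dim_row M}" by (auto intro!: image_eqI[of _ _ i])
  qed (auto simp: F_def)
  have surjG: "G ` {..<dim_col M} = {..<Suc k}"
  proof (intro equalityI subsetI)
    fix j' assume "j' \<in> {..<Suc k}"
    then obtain i Y where "mixed_cut (\<lambda>r y. M $$ (r, y)) Y i" "\<forall>y\<in>Y. y < dim_col M \<and> G y = j'"
      using cell[of 0 j'] by auto
    then show "j' \<in> G ` {..<dim_col M}" by (force simp: mixed_cut_def)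
  qed (auto simp: G_def)
  let ?R = "(\<lambda>i. {r. r < dim_row M \<and> F r = i}) ` {..<Suc k}"
  let ?C = "(\<lambda>j. {y. y < dim_col M \<and> G y = j}) ` {..<Suc k}"
  have "k_division (Suc k) M ?R ?C"
    using interval_division_fibres[OF mono'(1) surjF] interval_division_fibres[OF mono'(2) surjG]
    by (simp add: k_division_def)
  moreover have "mixed (submatrix M I J)" if IJ: "I \<in> ?R" "J \<in> ?C" for I J
  proof -
    obtain i' j' where ij: "i' < Suc k" "j' < Suc k"
      and I: "I = {r. r < dim_row M \<and> F r = i'}" and J: "J = {y. y < dim_col M \<and> G y = j'}"
      using IJ by auto
    obtain i Y where cut: "mixed_cut (\<lambda>r y. M $$ (r, y)) Y i" and i: "Suc i < dim_row M"
      "F i = i'" "F (Suc i) = i'" and Y: "\<forall>y\<in>Y. y < dim_col M \<and> G y = j'"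
      using cell[OF ij] by blast
    obtain y where y: "y \<in> Y" "M $$ (i, y) \<noteq> M $$ (Suc i, y)"
      using cut unfolding mixed_cut_def by blast
    obtain r q q' where rq: "r \<in> {i, Suc i}" "q \<in> Y" "q' \<in> Y" "M $$ (r, q) \<noteq> M $$ (r, q')"
      using cut unfolding mixed_cut_def by blast
    show ?thesis
      by (rule mixed_submatrixI[OF _ _ _ _ _ y(2) _ _ _ rq(4)]) (use y(1) rq(1-3) i Y I J in auto)
  qed
  ultimately show ?thesis unfolding mixed_minor_def by blast
qed

section \<open>Blocks of representative columns and the final count\<close>

theorem theorem22:
  fixes M :: "'a::zero_neq_one mat" and s t :: nat
  assumes "t \<ge> 1"
    and "s \<ge> 1"
    and "elements_mat M \<subseteq> {0, 1}"
    and "dim_row M = s"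
    and "real (card (set (cols M))) \<ge> 2 powr (4 * c (2 * t + 2)) * real s"
  shows "\<exists>R C. mixed_minor (2 * t + 2) M R C"
proof -
  define k where "k = 2 * t + 1"
  have k: "2 * t + 2 = Suc k" by (simp add: k_def)
  \<comment> \<open>The constant of \<open>grid_minor_free_card_le\<close>; it is at most
    \<open>c (Suc k)\<close> because 2 is at most 8/3.\<close>
  define L :: nat where "L = 2 * (k + 2)\<^sup>2 * 16 ^ Suc k"
  define K :: nat where "K = 2 ^ (4 * L)"
  have L1: "1 \<le> L" by (simp add: L_def)
  have "real L \<le> c (Suc k)"
  proof -
    have "(2::real) ^ (4 * Suc k) = 16 ^ Suc k" unfolding power_mult by simp
    then have "c (Suc k) = 8 / 3 * ((real k + 2)\<^sup>2 * 16 ^ Suc k)"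
      unfolding c_def by (simp add: add.commute)
    moreover have "real L = 2 * ((real k + 2)\<^sup>2 * 16 ^ Suc k)"
      by (simp add: L_def algebra_simps)
    moreover have "0 \<le> (real k + 2)\<^sup>2 * 16 ^ Suc k" by simp
    ultimately show ?thesis by linarith
  qed
  then have "real K \<le> 2 powr (4 * c (Suc k))"
    by (simp add: K_def flip: powr_realpow)
  then have "real K * real s \<le> real (card (set (cols M)))"
    using assms(5) mult_right_mono[of "real K" _ "real s"] unfolding k by fastforce
  then have Ks: "K * s \<le> card (set (cols M))"
    by (simp only: of_nat_le_iff flip: of_nat_mult)
  have "set (cols M) \<subseteq> col M ` {..<dim_col M}" by (auto simp: cols_def)
  then obtain Z where Z: "Z \<subseteq> {..<dim_col M}" "inj_on (col M) Z" "set (cols M) = col M ` Z"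
    by (auto simp: subset_image_inj)
  have finZ: "finite Z" using Z(1) finite_subset by blast
  have KZ: "K * s \<le> card Z" using Ks Z(2,3) by (simp add: card_image)
  \<comment> \<open>Being defined on all columns, \<open>rank\<close> also places the columns
    outside \<open>Z\<close> when the blocks are extended to a column division.\<close>
  define rank where "rank y = card {z\<in>Z. z < y}" for y
  have rank: "inj_on rank Z" "rank ` Z = {..<card Z}"
    using bij_betw_rank[OF finZ] by (auto simp: bij_betw_def rank_def[abs_def])
  define block where "block q = {y\<in>Z. rank y div K = q}" for q
  have K0: "0 < K" by (simp add: K_def)
  have block: "card (block q) = K" if "q < s" for q
  proof -
    have "Suc q * K \<le> s * K" using that by (intro mult_le_mono1) simp
    then have "q * K + K \<le> card Z" using KZ by (simp add: mult.commute)
    then have "rank ` block q = {q * K..<q * K + K}"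
    proof (intro equalityI subsetI)
      fix x assume "x \<in> {q * K..<q * K + K}"
      moreover from this have "x div K = q"
        by (metis add.commute atLeastLessThan_iff div_nat_eqI mult.commute mult_Suc)
      ultimately show "x \<in> rank ` block q"
        using rank(2) \<open>q * K + K \<le> card Z\<close> by (auto simp: block_def image_iff set_eq_iff) (metis order_less_le_trans)
    next
      fix x assume "x \<in> rank ` block q"
      then have "x div K = q" by (auto simp: block_def)
      then show "x \<in> {q * K..<q * K + K}"
        using K0 by (auto simp: dividend_less_div_times add.commute)
    qed
    moreover have "inj_on rank (block q)" using rank(1) by (rule inj_on_subset) (auto simp: block_def)
    ultimately show ?thesis by (metis card_image card_atLeastLessThan add_diff_cancel_left')
  qed
  define a where "a r y = M $$ (r, y)" for r y
  have a01: "a r y \<in> {0, 1}" if "r < s" "y \<in> Z" for r y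
    using that assms(3,4) Z(1) unfolding a_def by (auto intro!: elements_matI[of M])
  define D where "D q = {i. Suc i < s \<and> mixed_cut a (block q) i}" for q
  have finD: "finite (D q)" for q
    by (rule finite_subset[of _ "{..<s}"]) (auto simp: D_def)
  have D: "4 * L - 1 \<le> card (D q)" if "q < s" for q
  proof -
    \<comment> \<open>Representatives are pairwise distinct columns, so a block shows
      \<open>K\<close> column types.\<close>
    have "inj_on (\<lambda>y. map (\<lambda>r. a r y) [0..<s]) (block q)"
    proof (rule inj_onI)
      fix y y' assume yy: "y \<in> block q" "y' \<in> block q"
        "map (\<lambda>r. a r y) [0..<s] = map (\<lambda>r. a r y') [0..<s]"
      then have "col M y = col M y'"
        using assms(4) Z(1) by (intro eq_vecI) (auto simp: a_def block_def subset_eq)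
      then show "y = y'" using yy Z(2) by (auto simp: block_def inj_on_def)
    qed
    then have "K = card ((\<lambda>y. map (\<lambda>r. a r y) [0..<s]) ` block q)"
      using block[OF that] by (simp add: card_image)
    also have "\<dots> \<le> 2 ^ Suc (card (D q))"
      unfolding D_def by (rule card_column_types_le[of _ _ _ 0 1]) (use finZ a01 in \<open>auto simp: block_def\<close>)
    finally have "4 * L \<le> Suc (card (D q))"
      unfolding K_def by (subst (asm) power_increasing_iff) auto
    then show ?thesis by simp
  qed
  text \<open>Only row pairs starting at rows of one fixed parity are used, so that distinct entries
    of \<open>A e\<close> in one column stand for disjoint row pairs and no pair is cut by a row division.\<close>
  define A where "A e = {(j, q). q < s \<and> 2 * j + e \<in> D q}" for e
  have Asub: "A e \<subseteq> {..<s} \<times> {..<s}" for e by (auto simp: A_def D_def)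
  have finA: "finite (A e)" for e using finite_subset[OF Asub] by blast
  obtain e where e: "grid_minor (Suc k) (Suc k) (A e)"
  proof (rule ccontr)
    \<comment> \<open>The \<open>s\<close> blocks supply at least \<open>s * (4 * L - 1)\<close>
      cuts, while the two parity classes together would hold at most
      \<open>2 * L * s\<close>.\<close>
    assume "\<not> thesis"
    then have le: "card (A e) \<le> L * s" for e
      using grid_minor_free_card_le[OF Asub, of k e] that unfolding L_def by blast
    have "s * (4 * L - 1) \<le> (\<Sum>q<s. card (D q))"
      using sum_mono[of "{..<s}" "\<lambda>_. 4 * L - 1" "\<lambda>q. card (D q)"] D by simp
    also have "\<dots> = card (Sigma {..<s} D)" using finD by simp
    also have "\<dots> \<le> card ((\<lambda>(j, q). (q, 2 * j)) ` A 0 \<union> (\<lambda>(j, q). (q, Suc (2 * j))) ` A 1)"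
    proof (rule card_mono)
      show "Sigma {..<s} D \<subseteq> (\<lambda>(j, q). (q, 2 * j)) ` A 0 \<union> (\<lambda>(j, q). (q, Suc (2 * j))) ` A 1"
      proof
        fix x assume "x \<in> Sigma {..<s} D"
        then obtain q i where x: "x = (q, i)" "q < s" "i \<in> D q" by auto
        show "x \<in> (\<lambda>(j, q). (q, 2 * j)) ` A 0 \<union> (\<lambda>(j, q). (q, Suc (2 * j))) ` A 1"
        proof (cases "even i")
          case True
          then show ?thesis using x by (auto simp: A_def elim!: evenE)
        next
          case False
          then show ?thesis using x by (auto simp: A_def elim!: oddE)
        qed
      qed
    qed (use finA in auto)
    also have "\<dots> \<le> card (A 0) + card (A 1)"
      by (intro order_trans[OF card_Un_le] add_mono card_image_le finA)
    also have "\<dots> \<le> s * (2 * L)" using le[of 0] le[of 1] by (simp add: algebra_simps)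
    finally have "4 * L - 1 \<le> 2 * L" using assms(2) by simp
    then show False using L1 by simp
  qed
  show ?thesis unfolding k
  \<comment> \<open>The row label sends \<open>2 * j + e\<close> and its successor both to
    \<open>j\<close>; truncated subtraction gives rows below \<open>e\<close> the label 0, which
    keeps it monotone.\<close>
  proof (rule mixed_minorI[OF e, of "\<lambda>r. (r - e) div 2" "\<lambda>y. rank y div K"])
    show "mono (\<lambda>r. (r - e) div 2)" by (auto simp: mono_def intro!: div_le_mono)
    show "mono (\<lambda>y. rank y div K)"
      using mono_rank[OF finZ] by (auto simp: mono_def rank_def intro!: div_le_mono)
    fix j q assume "(j, q) \<in> A e"
    then have "2 * j + e \<in> D q" by (simp add: A_def)
    then show "\<exists>i Y. mixed_cut (\<lambda>r y. M $$ (r, y)) Y i \<and> Suc i < dim_row M \<and>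
        (i - e) div 2 = j \<and> (Suc i - e) div 2 = j \<and> (\<forall>y\<in>Y. y < dim_col M \<and> rank y div K = q)"
      using Z(1) assms(4)
      by (intro exI[of _ "2 * j + e"] exI[of _ "block q"])
        (auto simp: D_def block_def a_def[abs_def] Suc_diff_le)
  qed
qed

end
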